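(* Consider Bänsch bisections starting from an admissible initial Bänsch marked mesh. The two children of a Bänsch bisection have the same configuration and each has a unique global refinement edge. Thus only an unbisected tetrahedron of the initial mesh can have two global refinement edges. Writing $\mathrm{black}_i$ for a black tetrahedron $K$ with $\varepsilon_K=i$, the transition from the configuration of a parent to the common configuration of its two children is $$\mathrm{red}\longrightarrow\mathrm{black}_0\longrightarrow\mathrm{black}_1\longrightarrow\mathrm{red},\qquad \mathrm{unnamed}\longrightarrow\mathrm{black}_0 .$$
   Context: Tetrahedra are closed and nondegenerate in $\mathbb R^3$; $[\cdot]$ is the convex hull; $\mathcal E(X)$ is the edge set. **Face marking.** A Bänsch face marking assigns to each triangular face $F$ (as a geometric object, independently of the side) an edge $\mu_F\in\mathcal E(F)$. The set of global refinement edges of a tetrahedron $K$ is $\mathcal G(K)=\{e\in\mathcal E(K):\mu_F=e\text{ for both faces }F\subset K\text{ containing }e\}$. The marking is admissible if $\mathcal G(K)\neq\varnothing$ for every $K$. **Configurations.** Given a selected $[a,b]\in\mathcal G(K)$ with remaining vertices $c,d$, put $\mu_a=\mu_{[a,c,d]}$, $\mu_b=\mu_{[b,c,d]}$. $K$ is red if $(\mu_a,\mu_b)\in\{([a,c],[b,d]),([a,d],[b,c])\}$, black if $(\mu_a,\mu_b)\in\{([a,c],[b,c]),([a,d],[b,d])\}$, and otherwise (exactly one, or both, of $\mu_a,\mu_b$ equal $[c,d]$) unnamed. **Bisection.** Each tetrahedron carries a state $\varepsilon_K\in\{0,1\}$. Bisecting $K$ along a selected $[a,b]\in\mathcal G(K)$,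 with $z$ the midpoint of $[a,b]$, gives $K_a=[a,z,c,d]$ and $K_b=[b,z,c,d]$ with: (R1) an inherited face (a face of $K$) keeps its mark; (R2) a cut face is marked by its edge opposite $z$: $\mu_{[a,z,c]}=[a,c]$, $\mu_{[a,z,d]}=[a,d]$, $\mu_{[b,z,c]}=[b,c]$, $\mu_{[b,z,d]}=[b,d]$; (R3) if $\varepsilon_K=0$, $\mu_{[z,c,d]}=[c,d]$; if $\varepsilon_K=1$, then $K$ is black, there is a unique $w\in\{c,d\}$ with $(\mu_a,\mu_b)=([a,w],[b,w])$, and $\mu_{[z,c,d]}=[z,w]$; (R4) after the marks are assigned, $\varepsilon_{K_i}=1$ iff $K_i$ and $K$ are both black, $i\in\{a,b\}$. An admissible initial Bänsch marked mesh is a finite conforming tetrahedral mesh with an admissible face marking and $\varepsilon_K=0$ for all its tetrahedra; the tetrahedra considered are those of the initial mesh and those obtained from them by repeated bisection. *)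

theory Defs
  imports "HOL-Analysis.Analysis"
begin

type_synonym point = "real^3"

text \<open>
  Tetrahedra, faces and edges are point sets: a tetrahedron is a \<open>3 simplex\<close>, its triangular
  faces are its facets, and the edge set of a tetrahedron or triangle X is
  \<open>{e. e edge_of X}\<close>. A face marking is a single function on point sets, so that the mark of a
  face does not depend on the tetrahedron from which the face is seen; its values on sets that
  are not faces of the mesh are irrelevant.
\<close>

type_synonym face_marking = "point set \<Rightarrow> point set"

definition global_edges :: "face_marking \<Rightarrow> point set \<Rightarrow> point set set" where
  "global_edges \<mu> K = {e. e edge_of K \<and> (\<forall>F. F facet_of K \<and> e \<subseteq> F \<longrightarrow> \<mu> F = e)}"

definition labelled_tetrahedron ::
    "point set \<Rightarrow> point \<Rightarrow> point \<Rightarrow> point \<Rightarrow> point \<Rightarrow> bool" where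
  "labelled_tetrahedron K a b c d \<longleftrightarrow>
     distinct [a, b, c, d] \<and> \<not> affine_dependent {a, b, c, d} \<and> K = convex hull {a, b, c, d}"

datatype configuration = Red | Black | Unnamed

text \<open>Configuration of \<open>[a,b,c,d]\<close> with respect to the selected edge \<open>[a,b]\<close>.\<close>

definition config :: "face_marking \<Rightarrow> point \<Rightarrow> point \<Rightarrow> point \<Rightarrow> point \<Rightarrow> configuration" where
  "config \<mu> a b c d =
    (let \<mu>a = \<mu> (convex hull {a, c, d}); \<mu>b = \<mu> (convex hull {b, c, d}) in
     if (\<mu>a, \<mu>b) \<in> {(convex hull {a, c}, convex hull {b, d}),
                     (convex hull {a, d}, convex hull {b, c})} then Red
     else if (\<mu>a, \<mu>b) \<in> {(convex hull {a, c}, convex hull {b, c}),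
                          (convex hull {a, d}, convex hull {b, d})} then Black
     else Unnamed)"

text \<open>The configuration depends on the selected edge only, not on the labelling.\<close>

lemma config_swap:
  "config \<mu> b a c d = config \<mu> a b c d"
  "config \<mu> a b d c = config \<mu> a b c d"
proof -
  show "config \<mu> b a c d = config \<mu> a b c d"
    unfolding config_def Let_def insert_iff prod.inject empty_iff by argo
  show "config \<mu> a b d c = config \<mu> a b c d"
    unfolding config_def Let_def insert_iff prod.inject empty_iff
      insert_commute[of d c "{}"] by argo
qed

definition has_config :: "face_marking \<Rightarrow> point set \<Rightarrow> point set \<Rightarrow> configuration \<Rightarrow> bool" where
  "has_config \<mu> K e C \<longleftrightarrow> e \<in> global_edges \<mu> K \<and>
     (\<exists>a b c d. labelled_tetrahedron K a b c d \<and> e = convex hull {a, b} \<and> config \<mu> a b c d = C)"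

record marked_mesh =
  tets :: "point set set"
  mark :: face_marking
  eps :: "point set \<Rightarrow> nat"

definition admissible_initial_mesh :: "marked_mesh \<Rightarrow> bool" where
  "admissible_initial_mesh S \<longleftrightarrow>
     triangulation (tets S) \<and> (\<forall>K\<in>tets S. 3 simplex K) \<and>
     (\<forall>K\<in>tets S. \<forall>F. F facet_of K \<longrightarrow> mark S F edge_of F) \<and>
     (\<forall>K\<in>tets S. global_edges (mark S) K \<noteq> {}) \<and>
     (\<forall>K\<in>tets S. eps S K = 0)"

text \<open>
  Marks after the bisection of \<open>[a,b,c,d]\<close> along \<open>[a,b]\<close>; \<open>\<epsilon>\<close> is the state of the bisected
  tetrahedron. All faces other than the four halves of cut faces and the new interior face keep
  their marks. The definite description is only meaningful for a black tetrahedron.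
\<close>

definition bisect_mark ::
    "face_marking \<Rightarrow> nat \<Rightarrow> point \<Rightarrow> point \<Rightarrow> point \<Rightarrow> point \<Rightarrow> face_marking" where
  "bisect_mark \<mu> \<epsilon> a b c d = (let z = midpoint a b in
     \<mu>(convex hull {a, z, c} := convex hull {a, c},
       convex hull {a, z, d} := convex hull {a, d},
       convex hull {b, z, c} := convex hull {b, c},
       convex hull {b, z, d} := convex hull {b, d},
       convex hull {z, c, d} :=
         (if \<epsilon> = 0 then convex hull {c, d}
          else convex hull {z, THE w. w \<in> {c, d} \<and>
                 \<mu> (convex hull {a, c, d}) = convex hull {a, w} \<and>
                 \<mu> (convex hull {b, c, d}) = convex hull {b, w}})))"

text \<open>
  A child is called black here if it is black with respect to some global refinement edge of its
  own; no uniqueness of that edge is presupposed.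
\<close>

definition bisect :: "marked_mesh \<Rightarrow> point \<Rightarrow> point \<Rightarrow> point \<Rightarrow> point \<Rightarrow> marked_mesh" where
  "bisect S a b c d =
    (let z = midpoint a b; K = convex hull {a, b, c, d};
         Ka = convex hull {a, z, c, d}; Kb = convex hull {b, z, c, d};
         \<mu>' = bisect_mark (mark S) (eps S K) a b c d;
         new_eps = (\<lambda>L. if (\<exists>e. has_config \<mu>' L e Black) \<and> config (mark S) a b c d = Black
                        then 1 else 0)
     in \<lparr> tets = (tets S - {K}) \<union> {Ka, Kb}, mark = \<mu>',
          eps = (eps S)(Ka := new_eps Ka, Kb := new_eps Kb) \<rparr>)"

definition selectable :: "marked_mesh \<Rightarrow> point \<Rightarrow> point \<Rightarrow> point \<Rightarrow> point \<Rightarrow> bool" where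
  "selectable S a b c d \<longleftrightarrow>
     (\<exists>K\<in>tets S. labelled_tetrahedron K a b c d \<and> convex hull {a, b} \<in> global_edges (mark S) K)"

inductive reachable :: "marked_mesh \<Rightarrow> marked_mesh \<Rightarrow> bool" for S0 where
  start: "reachable S0 S0"
| step: "reachable S0 S \<Longrightarrow> selectable S a b c d \<Longrightarrow> reachable S0 (bisect S a b c d)"

text \<open>\<open>transition C i C' j\<close>: a parent of configuration C and state i may have children of
  configuration \<open>C'\<close> and state j. The states of red and unnamed tetrahedra are left open.\<close>

definition transition :: "configuration \<Rightarrow> nat \<Rightarrow> configuration \<Rightarrow> nat \<Rightarrow> bool" where
  "transition C i C' j \<longleftrightarrow>
     C = Red \<and> C' = Black \<and> j = 0 \<or>
     C = Black \<and> i = 0 \<and> C' = Black \<and> j = 1 \<or>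
     C = Black \<and> i = 1 \<and> C' = Red \<or>
     C = Unnamed \<and> C' = Black \<and> j = 0"

end

theory Submission
  imports Defs
begin

text \<open>
  The marks of the faces of a child are explicit: the two cut faces carry their old edges, the new
  face carries \<open>[c,d]\<close> or \<open>[z,w]\<close>, and the inherited face keeps its mark. A finite case distinction
  then gives the unique global refinement edge and the configuration of the child. What remains is
  that a bisection changes no mark of a tetrahedron already present, although marks are attached to
  point sets. The new interior face lies in the relative interior of the bisected tetrahedron, so
  no other tetrahedron has it as a face. A cut face may already be present on the other side. The
  bisection of a marked triangle is a deterministic tree, since cut faces are marked by the edge
  opposite the new vertex, and by induction two mesh faces with overlapping relative interiors lie
  on one branch of such a tree; so the mark of a cut face is the same from both sides.
\<close>

section \<open>Halves of a simplex\<close>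

text \<open>A vertex in \<open>A - B\<close> would lie in the affine hull of the other points of
  \<open>V\<close>.\<close>

lemma convex_hull_subset_iff_independent:
  fixes V :: "'a::euclidean_space set"
  assumes "\<not> affine_dependent V" "A \<subseteq> V" "B \<subseteq> V"
  shows "convex hull A \<subseteq> convex hull B \<longleftrightarrow> A \<subseteq> B"
proof
  assume sub: "convex hull A \<subseteq> convex hull B"
  show "A \<subseteq> B"
  proof
    fix x assume "x \<in> A"
    then have x: "x \<in> V" "x \<in> convex hull B"
      using assms(2) sub by (auto intro: hull_inc)
    show "x \<in> B"
    proof (rule ccontr)
      assume "x \<notin> B"
      then have "B \<subseteq> V - {x}"
        using assms by blast
      then have "x \<in> affine hull (V - {x})"
        using x(2) convex_hull_subset_affine_hull hull_mono[of B "V - {x}" affine] by blast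
      then show False
        using x(1) assms(1) unfolding affine_dependent_def by blast
    qed
  qed
qed (rule hull_mono)

text \<open>The vertices of a simplex are its extreme points, so the hull recovers them. No common
  independent superset is assumed, which suits triangles of different tetrahedra.\<close>

lemma convex_hull_eq_iff_independent:
  fixes A B :: "'a::euclidean_space set"
  assumes "\<not> affine_dependent A" "\<not> affine_dependent B"
  shows "convex hull A = convex hull B \<longleftrightarrow> A = B"
proof
  assume "convex hull A = convex hull B"
  then have "x \<in> A \<longleftrightarrow> x \<in> B" for x
    using extreme_point_of_convex_hull_affine_independent assms by metis
  then show "A = B"
    by blast
qed simp

lemma convex_hull_neqI:
  fixes A B :: "'a::euclidean_space set"
  assumes "\<not> affine_dependent A" "\<not> affine_dependent B" "p \<in> A" "p \<notin> B"
  shows "convex hull A \<noteq> convex hull B"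
  using convex_hull_eq_iff_independent[OF assms(1,2)] assms(3,4) by metis

lemma affine_hull_half:
  fixes a b :: "'a::euclidean_space"
  shows "affine hull (insert a (insert (midpoint a b) C)) = affine hull (insert a (insert b C))"
proof (intro equalityI hull_minimal affine_affine_hull)
  have "midpoint a b = (1/2) *\<^sub>R a + (1/2) *\<^sub>R b"
    by (simp add: midpoint_def scaleR_add_right)
  then have "midpoint a b \<in> affine hull (insert a (insert b C))"
    by (metis affine_affine_hull hull_inc insertI1 insertI2 mem_affine field_sum_of_halves)
  then show "insert a (insert (midpoint a b) C) \<subseteq> affine hull (insert a (insert b C))"
    using hull_subset[of "insert a (insert b C)" affine] by blast
  have "b = (-1) *\<^sub>R a + 2 *\<^sub>R midpoint a b"
    by (simp add: midpoint_def)
  then have "b \<in> affine hull (insert a (insert (midpoint a b) C))"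
    using mem_affine[OF affine_affine_hull, of a "insert a (insert (midpoint a b) C)" "midpoint a b" "-1" 2]
    by (simp add: hull_inc)
  then show "insert a (insert b C) \<subseteq> affine hull (insert a (insert (midpoint a b) C))"
    using hull_subset[of "insert a (insert (midpoint a b) C)" affine] by blast
qed

text \<open>A dimension count: the affine hull is unchanged, so the new set, which has at most
  \<open>card C + 2\<close> points, must have exactly that many. This gives independence and also
  keeps the midpoint out of \<open>C\<close>.\<close>

lemma independent_half:
  fixes a b :: "'a::euclidean_space"
  assumes "\<not> affine_dependent (insert a (insert b C))" "a \<noteq> b" "a \<notin> C" "b \<notin> C"
  shows "\<not> affine_dependent (insert a (insert (midpoint a b) C))" "midpoint a b \<notin> C"
proof -
  let ?S = "insert a (insert b C)" and ?T = "insert a (insert (midpoint a b) C)"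
  have fin: "finite C"
    using aff_independent_finite[OF assms(1)] by simp
  have dim: "aff_dim ?T = int (card ?S) - 1"
    using assms(1) affine_hull_half[of a b C] affine_independent_iff_card aff_dim_affine_hull
    by metis
  have S: "card ?S = card C + 2"
    using assms fin by simp
  have "int (card ?T) - 1 \<ge> aff_dim ?T"
    using fin by (intro aff_dim_le_card) auto
  then have T: "card ?T \<ge> card C + 2"
    using dim S by simp
  moreover have "card ?T \<le> card C + 2"
    using fin by (simp add: card_insert_if)
  ultimately show "\<not> affine_dependent ?T"
    using dim S fin by (simp add: affine_independent_iff_card)
  show "midpoint a b \<notin> C"
    using T fin by (auto simp: insert_absorb card_insert_if split: if_splits)
qed

lemma convex_hull_half_subset:
  fixes a b :: "'a::euclidean_space"
  shows "convex hull (insert a (insert (midpoint a b) C)) \<subseteq> convex hull (insert a (insert b C))"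
proof (intro hull_minimal convex_convex_hull)
  have "midpoint a b \<in> convex hull {a, b}"
    by (simp add: segment_convex_hull[symmetric])
  then have "midpoint a b \<in> convex hull (insert a (insert b C))"
    using hull_mono[of "{a, b}" "insert a (insert b C)" convex] by blast
  then show "insert a (insert (midpoint a b) C) \<subseteq> convex hull (insert a (insert b C))"
    using hull_subset[of "insert a (insert b C)" convex] by blast
qed

lemma rel_interior_half_subset:
  fixes a b :: "'a::euclidean_space"
  shows "rel_interior (convex hull (insert a (insert (midpoint a b) C)))
    \<subseteq> rel_interior (convex hull (insert a (insert b C)))"
  by (intro subset_rel_interior convex_hull_half_subset) (simp add: affine_hull_half)

text \<open>The halves lie on opposite sides of a hyperplane through \<open>C\<close> and the
  midpoint, given by a linear functional that is constant on the cut, larger at \<open>a\<close> and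
  smaller at \<open>b\<close>.\<close>

lemma halves_Int_subset:
  fixes a b :: "'a::euclidean_space"
  assumes "\<not> affine_dependent (insert a (insert b C))" "a \<noteq> b" "a \<notin> C" "b \<notin> C"
  shows "convex hull (insert a (insert (midpoint a b) C)) \<inter>
    convex hull (insert b (insert (midpoint a b) C)) \<subseteq> convex hull (insert (midpoint a b) C)"
proof -
  let ?z = "midpoint a b" and ?S = "insert a (insert b C)" and ?t = "\<lambda>x. - b + x"
  \<comment> \<open>Translating \<open>b\<close> to the origin turns affine into linear
    independence. Prescribing 2 at the image of \<open>a\<close> and 1 on that of \<open>C\<close>
    makes \<open>f\<close> equal to \<open>k - 1\<close> at \<open>b\<close>, \<open>k\<close> on
    \<open>C\<close> and at the midpoint, and \<open>k + 1\<close> at \<open>a\<close>.\<close>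
  have "independent (?t ` (?S - {b}))"
    using assms(1) affine_dependent_iff_dependent2[of b ?S] by simp
  then obtain f :: "'a \<Rightarrow> real" where f: "linear f"
    and fx: "\<And>x. x \<in> ?t ` (?S - {b}) \<Longrightarrow> f x = (if x = ?t a then 2 else 1)"
    using linear_independent_extend[of "?t ` (?S - {b})" "\<lambda>x. if x = ?t a then 2 else 1"] by blast
  define k where "k = f b + 1"
  have fa: "f a = k + 1"
    using fx[OF imageI, of a] assms(2) f by (simp add: linear_add linear_neg linear_diff k_def)
  have fC: "f x = k" if "x \<in> C" for x
  proof -
    have "x \<noteq> a" "x \<noteq> b"
      using assms that by auto
    then have "f (?t x) = 1"
      using fx[OF imageI, of x] that by simp
    then show ?thesis
      using f by (simp add: linear_diff k_def)
  qed
  have fb: "f b = k - 1"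
    by (simp add: k_def)
  have fz: "f ?z = k"
    unfolding midpoint_def using f fa fb by (simp add: linear_add linear_cmul field_simps)
  have lin: "f (u *\<^sub>R x + v *\<^sub>R y) = u * f x + v * f y" for u v x y
    using f by (simp add: linear_add linear_cmul)
  have conv: "convex {x. f x \<in> I}" if "convex I" for I
    using convex_linear_vimage[OF f that] by (simp add: vimage_def)
  have le: "convex hull (insert b (insert ?z C)) \<subseteq> {x. f x \<in> {..k}}"
    using fb fz fC by (intro hull_minimal conv) auto
  have eq: "convex hull (insert ?z C) \<subseteq> {x. f x \<in> {k}}"
    using fz fC by (intro hull_minimal conv) auto
  show ?thesis
  proof clarify
    fix x assume xa: "x \<in> convex hull (insert a (insert ?z C))"
      and xb: "x \<in> convex hull (insert b (insert ?z C))"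
    \<comment> \<open>The point is split into a multiple of \<open>a\<close> and a point of the cut.
      Then \<open>f x = k + u\<close>, while \<open>f x\<close> is at most \<open>k\<close> on the
      half at \<open>b\<close>, so \<open>u = 0\<close>.\<close>
    obtain u v y where uv: "0 \<le> u" "u + v = 1" "y \<in> convex hull (insert ?z C)"
      "x = u *\<^sub>R a + v *\<^sub>R y"
      using xa by (subst (asm) convex_hull_insert) auto
    have "f y = k"
      using uv(3) eq by auto
    then have "f x = u * (k + 1) + v * k"
      using uv(4) fa by (simp add: lin)
    also have "\<dots> = k + u"
      using uv(2) by algebra
    finally have "f x = k + u" .
    then have "u = 0"
      using xb le uv(1) by fastforce
    then show "x \<in> convex hull (insert ?z C)"
      using uv by simp
  qed
qed

text \<open>The halves meet only inside the cut, which is a proper face of the half at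
  \<open>a\<close> and so misses its relative interior.\<close>

lemma rel_interior_half_disjoint:
  fixes a b :: "'a::euclidean_space"
  assumes "\<not> affine_dependent (insert a (insert b C))" "a \<noteq> b" "a \<notin> C" "b \<notin> C"
  shows "rel_interior (convex hull (insert a (insert (midpoint a b) C))) \<inter>
    convex hull (insert b (insert (midpoint a b) C)) = {}"
proof -
  let ?Z = "insert (midpoint a b) C"
  note ind = independent_half(1)[OF assms]
  have aZ: "a \<notin> ?Z"
    using assms by (metis insert_iff midpoint_eq_endpoint(1))
  have "convex hull ?Z face_of convex hull (insert a ?Z)"
    using face_of_convex_hull_affine_independent[OF ind] by blast
  moreover have "convex hull ?Z \<noteq> convex hull (insert a ?Z)"
    using convex_hull_eq_iff_independent ind affine_independent_subset[OF ind subset_insertI] aZ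
    by (metis insertI1)
  ultimately have "convex hull ?Z \<inter> rel_interior (convex hull (insert a ?Z)) = {}"
    by (rule face_of_disjoint_rel_interior)
  then show ?thesis
    using halves_Int_subset[OF assms] rel_interior_subset by blast
qed

text \<open>A facet containing the midpoint of an edge contains the edge, so no facet contains the
  whole cut face.\<close>

lemma rel_interior_cut_subset:
  fixes a b :: "'a::euclidean_space"
  assumes "\<not> affine_dependent (insert a (insert b C))" "a \<noteq> b"
  shows "rel_interior (convex hull (insert (midpoint a b) C))
    \<subseteq> rel_interior (convex hull (insert a (insert b C)))"
proof
  let ?S = "insert a (insert b C)" and ?Z = "insert (midpoint a b) C"
  fix x assume x: "x \<in> rel_interior (convex hull ?Z)"
  have sub: "convex hull ?Z \<subseteq> convex hull ?S"
    using convex_hull_half_subset[of a b C] hull_mono[of ?Z "insert a ?Z" convex] by blast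
  have False if F: "F facet_of convex hull ?S" "x \<in> F" for F
  proof -
    have face: "F face_of convex hull ?S"
      using F facet_of_imp_face_of by blast
    then have Z: "convex hull ?Z \<subseteq> F"
      using subset_of_face_of[OF _ sub] x F by blast
    then have "midpoint a b \<in> F"
      by (meson hull_inc insertI1 subsetD)
    moreover have "midpoint a b \<in> open_segment a b"
      using assms by simp
    moreover have "a \<in> convex hull ?S" "b \<in> convex hull ?S"
      by (simp_all add: hull_inc)
    ultimately have "a \<in> F" "b \<in> F"
      using face unfolding face_of_def by blast+
    moreover have "C \<subseteq> F"
      using Z hull_subset[of ?Z convex] by blast
    ultimately have "convex hull ?S \<subseteq> F"
      using face_of_imp_convex[OF face] by (intro hull_minimal) auto
    then show False
      using F facet_of_irrefl face_of_imp_subset[OF face] by (metis subset_antisym)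
  qed
  moreover have "x \<in> convex hull ?S"
    using x sub rel_interior_subset by blast
  moreover have "polyhedron (convex hull ?S)"
    using aff_independent_finite[OF assms(1)] by (intro polytope_imp_polyhedron polytope_convex_hull)
  ultimately show "x \<in> rel_interior (convex hull ?S)"
    by (auto simp: rel_interior_of_polyhedron)
qed

section \<open>Tetrahedra and their global refinement edges\<close>

lemma facet_of_labelled_iff:
  assumes "labelled_tetrahedron K a b c d"
  shows "F facet_of K \<longleftrightarrow>
    F \<in> {convex hull {a, b, c}, convex hull {a, b, d}, convex hull {a, c, d}, convex hull {b, c, d}}"
proof -
  have D: "a \<noteq> b" "a \<noteq> c" "a \<noteq> d" "b \<noteq> c" "b \<noteq> d" "c \<noteq> d"
    and ind: "\<not> affine_dependent {a, b, c, d}" and K: "K = convex hull {a, b, c, d}"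
    using assms by (auto simp: labelled_tetrahedron_def)
  have "{a, b, c, d} - {a} = {b, c, d}" "{a, b, c, d} - {b} = {a, c, d}"
    "{a, b, c, d} - {c} = {a, b, d}" "{a, b, c, d} - {d} = {a, b, c}"
    using D by auto
  moreover have "(\<exists>u. u \<in> {a, b, c, d} \<and> F = convex hull ({a, b, c, d} - {u})) \<longleftrightarrow>
    F = convex hull ({a, b, c, d} - {a}) \<or> F = convex hull ({a, b, c, d} - {b}) \<or>
    F = convex hull ({a, b, c, d} - {c}) \<or> F = convex hull ({a, b, c, d} - {d})"
    by (simp only: insert_iff empty_iff simp_thms conj_disj_distribR ex_disj_distrib)
  moreover have "F \<noteq> {}" if "F = convex hull (insert x A)" for x A
    using that by (simp add: convex_hull_eq_empty)
  ultimately show ?thesis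
    unfolding K facet_of_convex_hull_affine_independent[OF ind] insert_iff empty_iff by metis
qed

lemma edge_of_independent_iff:
  fixes S :: "'a::euclidean_space set"
  assumes "\<not> affine_dependent S"
  shows "e edge_of convex hull S \<longleftrightarrow> (\<exists>x\<in>S. \<exists>y\<in>S. x \<noteq> y \<and> e = convex hull {x, y})"
proof -
  have "aff_dim (convex hull T) = 1 \<longleftrightarrow> card T = 2" if "T \<subseteq> S" for T
    using affine_independent_subset[OF assms that]
    by (auto simp: affine_independent_iff_card aff_dim_convex_hull)
  then have "e edge_of convex hull S \<longleftrightarrow> (\<exists>T\<subseteq>S. card T = 2 \<and> e = convex hull T)"
    unfolding edge_of_def face_of_convex_hull_affine_independent[OF assms] by auto
  moreover have "T \<subseteq> S \<and> card T = 2 \<longleftrightarrow> (\<exists>x\<in>S. \<exists>y\<in>S. x \<noteq> y \<and> T = {x, y})" for T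
    by (auto simp: card_2_iff)
  ultimately show ?thesis
    by metis
qed

lemma edge_of_triangle_iff:
  fixes a b c :: "'a::euclidean_space"
  assumes "\<not> affine_dependent {a, b, c}" "distinct [a, b, c]"
  shows "e edge_of convex hull {a, b, c} \<longleftrightarrow>
    e \<in> {convex hull {a, b}, convex hull {a, c}, convex hull {b, c}}"
proof -
  have "a \<noteq> b" "a \<noteq> c" "b \<noteq> c"
    using assms(2) by auto
  then show ?thesis
    by (simp add: edge_of_independent_iff[OF assms(1)] insert_commute) argo
qed

lemma edge_of_labelled_iff:
  assumes "labelled_tetrahedron K a b c d"
  shows "e edge_of K \<longleftrightarrow> e \<in> {convex hull {a, b}, convex hull {a, c}, convex hull {a, d},
    convex hull {b, c}, convex hull {b, d}, convex hull {c, d}}"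
proof -
  have D: "a \<noteq> b" "a \<noteq> c" "a \<noteq> d" "b \<noteq> c" "b \<noteq> d" "c \<noteq> d"
    and ind: "\<not> affine_dependent {a, b, c, d}" and K: "K = convex hull {a, b, c, d}"
    using assms by (auto simp: labelled_tetrahedron_def)
  show ?thesis
    unfolding K using D by (simp add: edge_of_independent_iff[OF ind] insert_commute) argo
qed

lemma labelled_perms:
  assumes "labelled_tetrahedron K a b c d"
  shows "labelled_tetrahedron K b a c d" "labelled_tetrahedron K a b d c"
    "labelled_tetrahedron K a c b d" "labelled_tetrahedron K c d a b"
proof -
  have "{b, a, c, d} = {a, b, c, d}" "{a, b, d, c} = {a, b, c, d}"
    "{a, c, b, d} = {a, b, c, d}" "{c, d, a, b} = {a, b, c, d}"
    by blast+
  then show "labelled_tetrahedron K b a c d" "labelled_tetrahedron K a b d c"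
    "labelled_tetrahedron K a c b d" "labelled_tetrahedron K c d a b"
    using assms unfolding labelled_tetrahedron_def by auto
qed

lemma labelled_hull_eq_iff:
  assumes "labelled_tetrahedron K a b c d" "A \<subseteq> {a, b, c, d}" "B \<subseteq> {a, b, c, d}"
  shows "convex hull A = convex hull B \<longleftrightarrow> A = B"
proof -
  have "\<not> affine_dependent {a, b, c, d}"
    using assms(1) by (simp add: labelled_tetrahedron_def)
  then show ?thesis
    by (intro convex_hull_eq_iff_independent) (use assms affine_independent_subset in blast)+
qed

lemma labelled_face_independent:
  assumes "labelled_tetrahedron K a b c d"
  shows "\<not> affine_dependent {a, b, c}" "\<not> affine_dependent {a, b, d}"
    "\<not> affine_dependent {a, c, d}" "\<not> affine_dependent {b, c, d}"
proof -
  have "\<not> affine_dependent {a, b, c, d}"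
    using assms by (simp add: labelled_tetrahedron_def)
  then show "\<not> affine_dependent {a, b, c}" "\<not> affine_dependent {a, b, d}"
    "\<not> affine_dependent {a, c, d}" "\<not> affine_dependent {b, c, d}"
    by (rule affine_independent_subset; blast)+
qed

text \<open>Of the four faces only the two through both \<open>a\<close> and \<open>b\<close>
  contain the edge, so the quantifier over faces becomes two equations.\<close>

lemma global_edge_iff:
  assumes "labelled_tetrahedron K a b c d"
  shows "convex hull {a, b} \<in> global_edges \<mu> K \<longleftrightarrow>
    \<mu> (convex hull {a, b, c}) = convex hull {a, b} \<and> \<mu> (convex hull {a, b, d}) = convex hull {a, b}"
proof -
  have D: "a \<noteq> b" "a \<noteq> c" "a \<noteq> d" "b \<noteq> c" "b \<noteq> d" "c \<noteq> d"
    and ind: "\<not> affine_dependent {a, b, c, d}"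
    using assms by (auto simp: labelled_tetrahedron_def)
  have sub: "convex hull A \<subseteq> convex hull B \<longleftrightarrow> A \<subseteq> B"
    if "A \<subseteq> {a, b, c, d}" "B \<subseteq> {a, b, c, d}" for A B
    using convex_hull_subset_iff_independent[OF ind that] .
  have "convex hull {a, b} \<in> global_edges \<mu> K \<longleftrightarrow>
    (\<forall>F\<in>{convex hull {a, b, c}, convex hull {a, b, d}, convex hull {a, c, d}, convex hull {b, c, d}}.
      convex hull {a, b} \<subseteq> F \<longrightarrow> \<mu> F = convex hull {a, b})"
    unfolding global_edges_def mem_Collect_eq facet_of_labelled_iff[OF assms]
      edge_of_labelled_iff[OF assms] Ball_def by (simp only: insertI1 simp_thms imp_conjL)
  then show ?thesis
    using D by (simp add: sub)
qed

text \<open>Relabelling reduces each of the six edges to \<open>global_edge_iff\<close>. In this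
  explicit form the global refinement edges can be computed from the four face marks.\<close>

lemma global_edges_labelled:
  assumes L: "labelled_tetrahedron K a b c d"
  shows "e \<in> global_edges \<mu> K \<longleftrightarrow>
    e = convex hull {a, b} \<and> \<mu> (convex hull {a, b, c}) = convex hull {a, b} \<and>
       \<mu> (convex hull {a, b, d}) = convex hull {a, b} \<or>
    e = convex hull {a, c} \<and> \<mu> (convex hull {a, b, c}) = convex hull {a, c} \<and>
       \<mu> (convex hull {a, c, d}) = convex hull {a, c} \<or>
    e = convex hull {a, d} \<and> \<mu> (convex hull {a, b, d}) = convex hull {a, d} \<and>
       \<mu> (convex hull {a, c, d}) = convex hull {a, d} \<or>
    e = convex hull {b, c} \<and> \<mu> (convex hull {a, b, c}) = convex hull {b, c} \<and>
       \<mu> (convex hull {b, c, d}) = convex hull {b, c} \<or>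
    e = convex hull {b, d} \<and> \<mu> (convex hull {a, b, d}) = convex hull {b, d} \<and>
       \<mu> (convex hull {b, c, d}) = convex hull {b, d} \<or>
    e = convex hull {c, d} \<and> \<mu> (convex hull {a, c, d}) = convex hull {c, d} \<and>
       \<mu> (convex hull {b, c, d}) = convex hull {c, d}"
proof -
  have g1: "convex hull {a, b} \<in> global_edges \<mu> K \<longleftrightarrow>
      \<mu> (convex hull {a, b, c}) = convex hull {a, b} \<and> \<mu> (convex hull {a, b, d}) = convex hull {a, b}"
    using global_edge_iff[OF L, of \<mu>] by (simp add: insert_commute)
  have g2: "convex hull {a, c} \<in> global_edges \<mu> K \<longleftrightarrow>
      \<mu> (convex hull {a, b, c}) = convex hull {a, c} \<and> \<mu> (convex hull {a, c, d}) = convex hull {a, c}"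
    using global_edge_iff[OF labelled_perms(3)[OF L], of \<mu>] by (simp add: insert_commute)
  have g3: "convex hull {a, d} \<in> global_edges \<mu> K \<longleftrightarrow>
      \<mu> (convex hull {a, b, d}) = convex hull {a, d} \<and> \<mu> (convex hull {a, c, d}) = convex hull {a, d}"
    using global_edge_iff[OF labelled_perms(3)[OF labelled_perms(2)[OF L]], of \<mu>]
    by (simp add: insert_commute)
  have g4: "convex hull {b, c} \<in> global_edges \<mu> K \<longleftrightarrow>
      \<mu> (convex hull {a, b, c}) = convex hull {b, c} \<and> \<mu> (convex hull {b, c, d}) = convex hull {b, c}"
    using global_edge_iff[OF labelled_perms(3)[OF labelled_perms(1)[OF L]], of \<mu>]
    by (simp add: insert_commute)
  have g5: "convex hull {b, d} \<in> global_edges \<mu> K \<longleftrightarrow>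
      \<mu> (convex hull {a, b, d}) = convex hull {b, d} \<and> \<mu> (convex hull {b, c, d}) = convex hull {b, d}"
    using global_edge_iff[OF labelled_perms(3)[OF labelled_perms(2)[OF labelled_perms(1)[OF L]]], of \<mu>]
    by (simp add: insert_commute)
  have g6: "convex hull {c, d} \<in> global_edges \<mu> K \<longleftrightarrow>
      \<mu> (convex hull {a, c, d}) = convex hull {c, d} \<and> \<mu> (convex hull {b, c, d}) = convex hull {c, d}"
    using global_edge_iff[OF labelled_perms(4)[OF L], of \<mu>] by (simp add: insert_commute)
  have "e \<in> global_edges \<mu> K \<longleftrightarrow> e edge_of K \<and> e \<in> global_edges \<mu> K"
    unfolding global_edges_def by blast
  also have "\<dots> \<longleftrightarrow> e = convex hull {a, b} \<and> convex hull {a, b} \<in> global_edges \<mu> K \<or>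
      e = convex hull {a, c} \<and> convex hull {a, c} \<in> global_edges \<mu> K \<or>
      e = convex hull {a, d} \<and> convex hull {a, d} \<in> global_edges \<mu> K \<or>
      e = convex hull {b, c} \<and> convex hull {b, c} \<in> global_edges \<mu> K \<or>
      e = convex hull {b, d} \<and> convex hull {b, d} \<in> global_edges \<mu> K \<or>
      e = convex hull {c, d} \<and> convex hull {c, d} \<in> global_edges \<mu> K"
    by (simp only: edge_of_labelled_iff[OF L] insert_iff empty_iff simp_thms conj_disj_distribR
        cong: conj_cong)
  finally show ?thesis
    unfolding g1 g2 g3 g4 g5 g6 .
qed

text \<open>Hulls determine their vertices, so two labellings of \<open>K\<close> with the same
  selected edge differ only by exchanging the ends of that edge and by exchanging the other two
  vertices; \<open>config_swap\<close> covers both.\<close>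

lemma has_configD:
  assumes "has_config \<mu> K (convex hull {a, b}) C" "labelled_tetrahedron K a b c d"
  shows "config \<mu> a b c d = C"
proof -
  obtain a' b' c' d' where L: "labelled_tetrahedron K a' b' c' d'"
    "convex hull {a, b} = convex hull {a', b'}" "config \<mu> a' b' c' d' = C"
    using assms unfolding has_config_def by blast
  have V: "{a, b, c, d} = {a', b', c', d'}"
    using L(1) assms(2) unfolding labelled_tetrahedron_def
    using convex_hull_eq_iff_independent[of "{a, b, c, d}" "{a', b', c', d'}"] by simp
  then have ab: "{a, b} = {a', b'}"
    using labelled_hull_eq_iff[OF L(1), of "{a, b}" "{a', b'}"] L(2) by blast
  have "{c, d} = {a, b, c, d} - {a, b}"
    using assms(2) by (auto simp: labelled_tetrahedron_def)
  also have "\<dots> = {c', d'}"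
    unfolding V ab using L(1) by (auto simp: labelled_tetrahedron_def)
  finally have "c = c' \<and> d = d' \<or> c = d' \<and> d = c'"
    by (simp add: doubleton_eq_iff)
  moreover have "a = a' \<and> b = b' \<or> a = b' \<and> b = a'"
    using ab by (simp add: doubleton_eq_iff)
  ultimately show ?thesis
    using L(3) config_swap by metis
qed

lemma has_configI:
  assumes "labelled_tetrahedron K a b c d" "convex hull {a, b} \<in> global_edges \<mu> K"
  shows "has_config \<mu> K (convex hull {a, b}) (config \<mu> a b c d)"
  using assms unfolding has_config_def by blast

section \<open>From the face marks of a child to its configuration\<close>

text \<open>Each edge of the inherited face \<open>{a, c, d}\<close> is the mark of the other face
  containing it. So the mark of the inherited face is global, and no other edge is, as the remaining
  three marks are pairwise distinct. The two faces not containing it are marked by the other two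
  edges of \<open>{a, c, d}\<close>, which share a vertex: this is black.\<close>

lemma child_black:
  assumes L: "labelled_tetrahedron K a z c d"
    and \<mu>: "\<mu> (convex hull {a, z, c}) = convex hull {a, c}"
      "\<mu> (convex hull {a, z, d}) = convex hull {a, d}"
      "\<mu> (convex hull {z, c, d}) = convex hull {c, d}"
    and edge: "\<mu> (convex hull {a, c, d}) edge_of convex hull {a, c, d}"
  shows "\<exists>e. global_edges \<mu> K = {e} \<and> has_config \<mu> K e Black"
proof -
  note eq = labelled_hull_eq_iff[OF L]
  have D: "a \<noteq> z" "a \<noteq> c" "a \<noteq> d" "z \<noteq> c" "z \<noteq> d" "c \<noteq> d"
    using L by (auto simp: labelled_tetrahedron_def)
  have *: ?thesis if "labelled_tetrahedron K p q r s" "global_edges \<mu> K = {convex hull {p, q}}"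
    "config \<mu> p q r s = Black" for p q r s
    using has_configI[OF that(1), of \<mu>] that(2,3) by auto
  have "\<mu> (convex hull {a, c, d}) \<in> {convex hull {a, c}, convex hull {a, d}, convex hull {c, d}}"
    using edge edge_of_triangle_iff[OF labelled_face_independent(3)[OF L]] D by simp
  then show ?thesis
  proof (elim insertE emptyE)
    assume acd: "\<mu> (convex hull {a, c, d}) = convex hull {a, c}"
    show ?thesis
    proof (rule *)
      show "labelled_tetrahedron K a c d z"
        using labelled_perms(2)[OF labelled_perms(3)[OF L]] .
      show "global_edges \<mu> K = {convex hull {a, c}}"
        by (rule set_eqI) (use D in \<open>simp add: global_edges_labelled[OF L] \<mu> acd eq doubleton_eq_iff\<close>)
      have "\<mu> (convex hull {a, d, z}) = convex hull {a, d}" "\<mu> (convex hull {c, d, z}) = convex hull {c, d}"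
        using \<mu> by (simp_all add: insert_commute)
      then show "config \<mu> a c d z = Black"
        using D by (simp add: config_def eq doubleton_eq_iff)
    qed
  next
    assume acd: "\<mu> (convex hull {a, c, d}) = convex hull {a, d}"
    show ?thesis
    proof (rule *)
      show "labelled_tetrahedron K a d c z"
        using labelled_perms(2)[OF labelled_perms(3)[OF labelled_perms(2)[OF L]]] .
      show "global_edges \<mu> K = {convex hull {a, d}}"
        by (rule set_eqI) (use D in \<open>simp add: global_edges_labelled[OF L] \<mu> acd eq doubleton_eq_iff\<close>)
      have "\<mu> (convex hull {a, c, z}) = convex hull {a, c}" "\<mu> (convex hull {d, c, z}) = convex hull {d, c}"
        using \<mu> by (simp_all add: insert_commute)
      then show "config \<mu> a d c z = Black"
        using D by (simp add: config_def eq doubleton_eq_iff)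
    qed
  next
    assume acd: "\<mu> (convex hull {a, c, d}) = convex hull {c, d}"
    show ?thesis
    proof (rule *)
      show "labelled_tetrahedron K c d a z"
        using labelled_perms(4)[OF L] .
      show "global_edges \<mu> K = {convex hull {c, d}}"
        by (rule set_eqI) (use D in \<open>simp add: global_edges_labelled[OF L] \<mu> acd eq doubleton_eq_iff\<close>)
      have "\<mu> (convex hull {c, a, z}) = convex hull {c, a}" "\<mu> (convex hull {d, a, z}) = convex hull {d, a}"
        using \<mu> by (simp_all add: insert_commute)
      then show "config \<mu> c d a z = Black"
        using D by (simp add: config_def eq doubleton_eq_iff)
    qed
  qed
qed

text \<open>Here \<open>c\<close> is the vertex \<open>w\<close> of the bisection rule. Only the
  edge \<open>{a, c}\<close> occurs twice among the four marks, and the faces not containing it are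
  marked by the disjoint edges \<open>{a, d}\<close> and \<open>{z, c}\<close>: this is red.\<close>

lemma child_red:
  assumes L: "labelled_tetrahedron K a z c d"
    and \<mu>: "\<mu> (convex hull {a, z, c}) = convex hull {a, c}"
      "\<mu> (convex hull {a, z, d}) = convex hull {a, d}"
      "\<mu> (convex hull {z, c, d}) = convex hull {z, c}"
      "\<mu> (convex hull {a, c, d}) = convex hull {a, c}"
  shows "\<exists>e. global_edges \<mu> K = {e} \<and> has_config \<mu> K e Red"
proof -
  note eq = labelled_hull_eq_iff[OF L]
  have D: "a \<noteq> z" "a \<noteq> c" "a \<noteq> d" "z \<noteq> c" "z \<noteq> d" "c \<noteq> d"
    using L by (auto simp: labelled_tetrahedron_def)
  have "global_edges \<mu> K = {convex hull {a, c}}"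
    by (rule set_eqI) (use D in \<open>simp add: global_edges_labelled[OF L] \<mu> eq doubleton_eq_iff\<close>)
  moreover have "\<mu> (convex hull {a, d, z}) = convex hull {a, d}" "\<mu> (convex hull {c, d, z}) = convex hull {c, z}"
    using \<mu> by (simp_all add: insert_commute)
  then have "config \<mu> a c d z = Red"
    by (simp add: config_def)
  moreover have "labelled_tetrahedron K a c d z"
    using labelled_perms(2)[OF labelled_perms(3)[OF L]] .
  ultimately show ?thesis
    using has_configI[of K a c d z \<mu>] by auto
qed

section \<open>The bisection tree of a marked triangle\<close>

text \<open>\<open>subface G g F e\<close>: bisecting the triangle F with mark e, and repeatedly its halves,
  produces G with mark g. The half at b is covered by exchanging the names of a and b.\<close>

inductive subface ::
    "'a::euclidean_space set \<Rightarrow> 'a set \<Rightarrow> 'a set \<Rightarrow> 'a set \<Rightarrow> bool" for G g where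
  refl: "subface G g G g"
| half: "\<not> affine_dependent {a, b, c} \<Longrightarrow> distinct [a, b, c] \<Longrightarrow>
    subface G g (convex hull {a, midpoint a b, c}) (convex hull {a, c}) \<Longrightarrow>
    subface G g (convex hull {a, b, c}) (convex hull {a, b})"

definition comparable_faces ::
    "'a::euclidean_space set \<Rightarrow> 'a set \<Rightarrow> 'a set \<Rightarrow> 'a set \<Rightarrow> bool" where
  "comparable_faces F e G g \<longleftrightarrow> subface F e G g \<or> subface G g F e"

lemma subface_trans:
  assumes "subface G g F e" "subface H h G g"
  shows "subface H h F e"
  using assms by (induction rule: subface.induct) (auto intro: subface.half)

lemma rel_interior_subface:
  assumes "subface G g F e"
  shows "rel_interior G \<subseteq> rel_interior F"
  using assms
proof (induction rule: subface.induct)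
  case (half a b c)
  then show ?case
    using rel_interior_half_subset[of a b "{c}"] by (meson order_trans)
qed simp

lemma triangle_half_subset:
  fixes a b c :: "'a::euclidean_space"
  assumes "\<not> affine_dependent {a, b, c}" "distinct [a, b, c]"
  shows "convex hull {a, midpoint a b, c} \<subset> convex hull {a, b, c}"
proof -
  have D: "a \<noteq> b" "a \<notin> {c}" "b \<notin> {c}"
    using assms(2) by auto
  have "b \<noteq> midpoint a b"
    using D(1) by (metis midpoint_eq_endpoint(2))
  then have "b \<notin> {a, midpoint a b, c}"
    using D by auto
  then have "{a, midpoint a b, c} \<noteq> {a, b, c}"
    by blast
  then have "convex hull {a, midpoint a b, c} \<noteq> convex hull {a, b, c}"
    by (simp only: convex_hull_eq_iff_independent[OF independent_half(1)[OF assms(1) D] assms(1)]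
        not_False_eq_True)
  then show ?thesis
    using convex_hull_half_subset[of a b "{c}"] by blast
qed

lemma subface_psubset:
  assumes "subface G g F e"
  shows "G = F \<and> g = e \<or> G \<subset> F"
  using assms
proof (induction rule: subface.induct)
  case (half a b c)
  then show ?case
    using triangle_half_subset[of a b c] by (meson psubset_trans)
qed simp

text \<open>Halves are strictly smaller than the bisected triangle, so no triangle reappears deeper
  in its own tree with another mark.\<close>

lemma comparable_faces_same:
  "comparable_faces F e F g \<Longrightarrow> e = g"
  unfolding comparable_faces_def using subface_psubset by blast

lemma comparable_faces_refl: "comparable_faces F e F e"
  by (simp add: comparable_faces_def subface.refl)

lemma comparable_faces_sym: "comparable_faces F e G g \<longleftrightarrow> comparable_faces G g F e"
  by (auto simp: comparable_faces_def)

text \<open>Inversion gives unknown labels \<open>a'\<close>, \<open>b'\<close>, \<open>c'\<close>.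
  The triangle and its marked edge determine them up to exchanging the ends of the edge, since the
  third is the vertex off the edge; the exchange accounts for the half at \<open>b\<close>.\<close>

lemma subface_triangle_cases:
  assumes ind: "\<not> affine_dependent {a, b, c}" and dist: "distinct [a, b, c]"
    and sub: "subface G g (convex hull {a, b, c}) (convex hull {a, b})"
  obtains "G = convex hull {a, b, c}" "g = convex hull {a, b}"
    | "subface G g (convex hull {a, midpoint a b, c}) (convex hull {a, c})"
    | "subface G g (convex hull {b, midpoint a b, c}) (convex hull {b, c})"
proof -
  from sub show thesis
  proof (cases rule: subface.cases)
    case refl
    then show thesis
      by (intro that(1)) auto
  next
    case (half a' b' c')
    have ind2: "\<not> affine_dependent {a, b}" "\<not> affine_dependent {a', b'}"
      by simp_all
    have V: "{a, b, c} = {a', b', c'}"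
      using half(1,3) convex_hull_eq_iff_independent[OF ind half(3)] by blast
    have ab: "{a, b} = {a', b'}"
      using half(2) convex_hull_eq_iff_independent[OF ind2] by blast
    have "{c} = {a, b, c} - {a, b}"
      using dist by auto
    also have "\<dots> = {c'}"
      unfolding V ab using half(4) by auto
    finally have c: "c' = c"
      by simp
    have "a' = a \<and> b' = b \<or> a' = b \<and> b' = a"
      using ab by (simp add: doubleton_eq_iff) argo
    then show thesis
      using half(5) that(2,3) c by (auto simp: midpoint_sym)
  qed
qed

text \<open>If \<open>{a, b, c}\<close> descends from \<open>G\<close>, so does its half. Otherwise
  \<open>G\<close> is that triangle or descends from one of its halves, and \<open>meet\<close>
  excludes the half at \<open>b\<close>.\<close>

lemma comparable_faces_half:
  assumes ind: "\<not> affine_dependent {a, b, c}" and dist: "distinct [a, b, c]"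
    and comp: "comparable_faces G g (convex hull {a, b, c}) (convex hull {a, b})"
    and meet: "rel_interior (convex hull {a, midpoint a b, c}) \<inter> rel_interior G \<noteq> {}"
  shows "comparable_faces G g (convex hull {a, midpoint a b, c}) (convex hull {a, c})"
proof -
  have half: "subface (convex hull {a, midpoint a b, c}) (convex hull {a, c})
      (convex hull {a, b, c}) (convex hull {a, b})"
    using subface.half[OF ind dist subface.refl] .
  show ?thesis
  proof (cases "subface (convex hull {a, b, c}) (convex hull {a, b}) G g")
    case True
    then show ?thesis
      using subface_trans[OF True half] by (simp add: comparable_faces_def)
  next
    case False
    then have "subface G g (convex hull {a, b, c}) (convex hull {a, b})"
      using comp by (simp add: comparable_faces_def)
    with ind dist show ?thesis
    proof (cases rule: subface_triangle_cases)
      case 1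
      then show ?thesis
        using half by (simp add: comparable_faces_def)
    next
      case 2
      then show ?thesis
        by (simp add: comparable_faces_def)
    next
      case 3
      have "rel_interior (convex hull {a, midpoint a b, c}) \<inter> convex hull {b, midpoint a b, c} = {}"
        using dist by (intro rel_interior_half_disjoint[OF ind]) auto
      then show ?thesis
        using meet rel_interior_subface[OF 3] rel_interior_subset by blast
    qed
  qed
qed

section \<open>Invariants of an intermediate mesh\<close>

definition mesh_faces :: "point set set \<Rightarrow> point set set" where
  "mesh_faces T = {F. \<exists>K\<in>T. F facet_of K}"

lemma global_edges_cong:
  assumes "\<And>F. F facet_of K \<Longrightarrow> \<mu> F = \<nu> F"
  shows "global_edges \<mu> K = global_edges \<nu> K"
  unfolding global_edges_def using assms by (metis (no_types, lifting))

lemma has_config_cong: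
  assumes "\<And>F. F facet_of K \<Longrightarrow> \<mu> F = \<nu> F"
  shows "has_config \<mu> K e C \<longleftrightarrow> has_config \<nu> K e C"
proof -
  have "config \<mu> a b c d = config \<nu> a b c d" if "labelled_tetrahedron K a b c d" for a b c d
    using assms facet_of_labelled_iff[OF that] by (simp add: config_def)
  moreover have "global_edges \<mu> K = global_edges \<nu> K"
    using assms by (rule global_edges_cong)
  ultimately show ?thesis
    unfolding has_config_def by (simp cong: conj_cong)
qed

lemma labelled_imp_simplex:
  assumes "labelled_tetrahedron K a b c d"
  shows "3 simplex K"
  using assms unfolding labelled_tetrahedron_def simplex_def
  by (intro exI[of _ "{a, b, c, d}"]) auto

text \<open>Two tetrahedra of a nonconforming intermediate mesh may see the same cut face from its two
  sides at different times; \<open>faces_comparable\<close> is what makes the second bisection assign the mark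
  that the face already has. A facet of a mesh tetrahedron can also properly contain a facet of its
  neighbour, hence comparability in the bisection tree instead of equality.\<close>

locale bansch_mesh =
  fixes T0 :: "point set set" and S :: marked_mesh
  assumes tets_simplex: "K \<in> tets S \<Longrightarrow> 3 simplex K"
    and tets_disjoint: "K \<in> tets S \<Longrightarrow> L \<in> tets S \<Longrightarrow> K \<noteq> L \<Longrightarrow> rel_interior K \<inter> L = {}"
    and mark_edge: "F \<in> mesh_faces (tets S) \<Longrightarrow> mark S F edge_of F"
    and global_nonempty: "K \<in> tets S \<Longrightarrow> global_edges (mark S) K \<noteq> {}"
    and faces_comparable: "F \<in> mesh_faces (tets S) \<Longrightarrow> G \<in> mesh_faces (tets S) \<Longrightarrow>
      rel_interior F \<inter> rel_interior G \<noteq> {} \<Longrightarrow> comparable_faces F (mark S F) G (mark S G)"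
    and eps_cases: "K \<in> tets S \<Longrightarrow> eps S K = 0 \<or> eps S K = 1 \<and>
      (\<exists>e. global_edges (mark S) K = {e} \<and> has_config (mark S) K e Black)"
    and global_unique: "K \<in> tets S \<Longrightarrow> K \<notin> T0 \<Longrightarrow> \<exists>e. global_edges (mark S) K = {e}"
begin

text \<open>A facet of \<open>K\<close> is a proper face of \<open>K\<close>; a facet of another
  tetrahedron is kept out by \<open>tets_disjoint\<close>. This later shows that the interior face
  of a bisection is new.\<close>

lemma face_disjoint_tet:
  assumes "F \<in> mesh_faces (tets S)" "K \<in> tets S"
  shows "F \<inter> rel_interior K = {}"
proof -
  obtain L where L: "L \<in> tets S" "F facet_of L"
    using assms(1) by (auto simp: mesh_faces_def)
  show ?thesis
  proof (cases "L = K")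
    case True
    then have "F face_of K" "F \<noteq> K"
      using L facet_of_imp_face_of facet_of_irrefl by blast+
    then show ?thesis
      by (rule face_of_disjoint_rel_interior)
  next
    case False
    then show ?thesis
      using tets_disjoint[OF assms(2) L(1)] facet_of_imp_subset[OF L(2)] by blast
  qed
qed

lemma half_comparable:
  assumes ind: "\<not> affine_dependent {a, b, c}" and dist: "distinct [a, b, c]"
    and F: "convex hull {a, b, c} \<in> mesh_faces (tets S)"
      "mark S (convex hull {a, b, c}) = convex hull {a, b}"
    and G: "G \<in> mesh_faces (tets S)"
    and meet: "rel_interior (convex hull {a, midpoint a b, c}) \<inter> rel_interior G \<noteq> {}"
  shows "comparable_faces G (mark S G) (convex hull {a, midpoint a b, c}) (convex hull {a, c})"
proof (rule comparable_faces_half[OF ind dist _ meet])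
  have "rel_interior G \<inter> rel_interior (convex hull {a, b, c}) \<noteq> {}"
    using meet rel_interior_half_subset[of a b "{c}"] by blast
  then show "comparable_faces G (mark S G) (convex hull {a, b, c}) (convex hull {a, b})"
    using faces_comparable[OF G F(1)] F(2) by metis
qed

text \<open>The half is comparable with itself under its present mark and the mark that bisection
  prescribes, and comparability on a single triangle forces equal marks. This is the agreement of a
  cut face seen from its two sides.\<close>

lemma mark_half:
  assumes ind: "\<not> affine_dependent {a, b, c}" and dist: "distinct [a, b, c]"
    and F: "convex hull {a, b, c} \<in> mesh_faces (tets S)"
      "mark S (convex hull {a, b, c}) = convex hull {a, b}"
    and G: "convex hull {a, midpoint a b, c} \<in> mesh_faces (tets S)"
  shows "mark S (convex hull {a, midpoint a b, c}) = convex hull {a, c}"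
proof (rule comparable_faces_same[OF half_comparable[OF ind dist F G]])
  have "rel_interior (convex hull {a, midpoint a b, c}) \<noteq> {}"
    by (simp add: rel_interior_eq_empty convex_hull_eq_empty)
  then show "rel_interior (convex hull {a, midpoint a b, c}) \<inter>
      rel_interior (convex hull {a, midpoint a b, c}) \<noteq> {}"
    by simp
qed

end

section \<open>The initial mesh\<close>

text \<open>By conformity, faces with meeting relative interiors are equal, so comparability reduces
  to reflexivity. Uniqueness of global refinement edges is vacuous, as \<open>T0\<close> is the
  whole mesh.\<close>

lemma initial_bansch_mesh:
  assumes "admissible_initial_mesh S"
  shows "bansch_mesh (tets S) S"
proof
  have tri: "(K \<inter> L) face_of K" if "K \<in> tets S" "L \<in> tets S" for K L
    using assms that unfolding admissible_initial_mesh_def triangulation_def by blast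
  have simp: "3 simplex K" if "K \<in> tets S" for K
    using assms that unfolding admissible_initial_mesh_def by blast
  show "3 simplex K" if "K \<in> tets S" for K
    using simp that .
  show "rel_interior K \<inter> L = {}" if "K \<in> tets S" "L \<in> tets S" "K \<noteq> L" for K L
  proof -
    \<comment> \<open>Otherwise \<open>K\<close> would be a proper face of \<open>L\<close>,
      although both have dimension 3.\<close>
    have "K \<inter> L \<noteq> K"
    proof
      assume "K \<inter> L = K"
      then have "K face_of L"
        using tri[OF that(2,1)] by (simp add: Int_commute)
      moreover have "convex L"
        using simp[OF that(2)] convex_convex_hull unfolding simplex_def by blast
      ultimately have "aff_dim K < aff_dim L"
        using face_of_aff_dim_lt that(3) by blast
      then show False
        using aff_dim_simplex[OF simp[OF that(1)]] aff_dim_simplex[OF simp[OF that(2)]] by simp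
    qed
    then have "(K \<inter> L) \<inter> rel_interior K = {}"
      using face_of_disjoint_rel_interior[OF tri[OF that(1,2)]] by blast
    then show ?thesis
      using rel_interior_subset by blast
  qed
  show "mark S F edge_of F" if "F \<in> mesh_faces (tets S)" for F
    using assms that unfolding admissible_initial_mesh_def mesh_faces_def by blast
  show "global_edges (mark S) K \<noteq> {}" if "K \<in> tets S" for K
    using assms that unfolding admissible_initial_mesh_def by blast
  show "comparable_faces F (mark S F) G (mark S G)"
    if FG: "F \<in> mesh_faces (tets S)" "G \<in> mesh_faces (tets S)"
      and meet: "rel_interior F \<inter> rel_interior G \<noteq> {}" for F G
  proof -
    obtain K L where K: "K \<in> tets S" "F facet_of K" and L: "L \<in> tets S" "G facet_of L"
      using FG unfolding mesh_faces_def by blast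
    have F: "F face_of K" "F \<subseteq> K" and G: "G face_of L" "G \<subseteq> L"
      using K L by (simp_all add: facet_of_imp_face_of facet_of_imp_subset)
    have meet': "rel_interior F \<inter> L \<noteq> {}" "rel_interior G \<inter> K \<noteq> {}"
      using meet F(2) G(2) rel_interior_subset[of F] rel_interior_subset[of G] by blast+
    have KL: "(K \<inter> L) face_of K" "(K \<inter> L) face_of L"
      using tri[OF K(1) L(1)] tri[OF L(1) K(1)] by (simp_all add: Int_commute)
    \<comment> \<open>A face of \<open>K\<close> that meets the relative interior of
      \<open>F\<close> contains all of \<open>F\<close>. So both facets become faces of the common
      face \<open>K \<inter> L\<close>, and meeting relative interiors make them equal.\<close>
    have "F \<subseteq> K \<inter> L"
      using subset_of_face_of[OF KL(1) F(2)] meet'(1) F(2) rel_interior_subset[of F] by blast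
    moreover have "G \<subseteq> K \<inter> L"
      using subset_of_face_of[OF KL(2) G(2)] meet'(2) G(2) rel_interior_subset[of G] by blast
    ultimately have "F face_of K \<inter> L" "G face_of K \<inter> L"
      using face_of_subset[OF F(1), of "K \<inter> L"] face_of_subset[OF G(1), of "K \<inter> L"] by blast+
    then have "F = G"
      using face_of_eq meet by blast
    then show ?thesis
      by (simp add: comparable_faces_refl)
  qed
  show "eps S K = 0 \<or> eps S K = 1 \<and>
      (\<exists>e. global_edges (mark S) K = {e} \<and> has_config (mark S) K e Black)" if "K \<in> tets S" for K
    using assms that unfolding admissible_initial_mesh_def by blast
qed blast

section \<open>A single bisection\<close>

locale bisection = bansch_mesh +
  fixes a b c d :: point
  assumes selected: "selectable S a b c d"
begin

abbreviation z where "z \<equiv> midpoint a b"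
abbreviation K where "K \<equiv> convex hull {a, b, c, d}"
abbreviation Ka where "Ka \<equiv> convex hull {a, z, c, d}"
abbreviation Kb where "Kb \<equiv> convex hull {b, z, c, d}"
abbreviation S' where "S' \<equiv> bisect S a b c d"
abbreviation Z where "Z \<equiv> convex hull {z, c, d}"
abbreviation halves where "halves \<equiv>
  {convex hull {a, z, c}, convex hull {a, z, d}, convex hull {b, z, c}, convex hull {b, z, d}}"

lemma labelled: "labelled_tetrahedron K a b c d"
  using selected by (auto simp: selectable_def labelled_tetrahedron_def)

lemma K_in: "K \<in> tets S"
  using selected by (auto simp: selectable_def labelled_tetrahedron_def)

lemma ab_global: "convex hull {a, b} \<in> global_edges (mark S) K"
  using selected by (auto simp: selectable_def labelled_tetrahedron_def)

lemma independent: "\<not> affine_dependent {a, b, c, d}"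
  using labelled by (simp add: labelled_tetrahedron_def)

lemma vertices_distinct: "a \<noteq> b" "a \<noteq> c" "a \<noteq> d" "b \<noteq> c" "b \<noteq> d" "c \<noteq> d"
  using labelled by (auto simp: labelled_tetrahedron_def)

lemma midpoint_distinct: "z \<noteq> a" "z \<noteq> b" "z \<noteq> c" "z \<noteq> d"
  using vertices_distinct independent_half(2)[OF independent]
  by (auto simp: midpoint_eq_endpoint)

lemma labelled_Ka: "labelled_tetrahedron Ka a z c d"
  using vertices_distinct midpoint_distinct midpoint_distinct[symmetric] independent_half(1)[OF independent]
  by (auto simp: labelled_tetrahedron_def)

lemma labelled_Kb: "labelled_tetrahedron Kb b z c d"
proof -
  have "\<not> affine_dependent {b, a, c, d}"
    using independent by (simp add: insert_commute)
  then show ?thesis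
    using vertices_distinct midpoint_distinct midpoint_distinct[symmetric] independent_half(1)[of b a "{c, d}"]
    by (auto simp: labelled_tetrahedron_def midpoint_sym)
qed

section \<open>Faces and marks after the bisection\<close>

lemma faces_in:
  "convex hull {a, b, c} \<in> mesh_faces (tets S)" "convex hull {a, b, d} \<in> mesh_faces (tets S)"
  "convex hull {a, c, d} \<in> mesh_faces (tets S)" "convex hull {b, c, d} \<in> mesh_faces (tets S)"
  unfolding mesh_faces_def mem_Collect_eq
  by (rule bexI[OF _ K_in], simp add: facet_of_labelled_iff[OF labelled])+

lemma ab_marked:
  "mark S (convex hull {a, b, c}) = convex hull {a, b}"
  "mark S (convex hull {a, b, d}) = convex hull {a, b}"
  using ab_global global_edge_iff[OF labelled, of "mark S"] by simp_all

text \<open>The marks are written by successive function updates, so the five triangles must be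
  pairwise distinct for no update to overwrite another. Each pair is told apart by a vertex of only
  one of them.\<close>

lemma new_marks:
  "mark S' (convex hull {a, z, c}) = convex hull {a, c}"
  "mark S' (convex hull {a, z, d}) = convex hull {a, d}"
  "mark S' (convex hull {b, z, c}) = convex hull {b, c}"
  "mark S' (convex hull {b, z, d}) = convex hull {b, d}"
  "mark S' Z = (if eps S K = 0 then convex hull {c, d}
     else convex hull {z, THE w. w \<in> {c, d} \<and>
       mark S (convex hull {a, c, d}) = convex hull {a, w} \<and>
       mark S (convex hull {b, c, d}) = convex hull {b, w}})"
proof -
  note ind = labelled_face_independent[OF labelled_Ka] labelled_face_independent[OF labelled_Kb]
  note N = vertices_distinct vertices_distinct[symmetric] midpoint_distinct midpoint_distinct[symmetric]
  have ne12: "convex hull {a, z, c} \<noteq> convex hull {a, z, d}"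
    by (rule convex_hull_neqI[OF ind(1) ind(2), of c]) (simp_all add: N)
  have ne13: "convex hull {a, z, c} \<noteq> convex hull {b, z, c}"
    by (rule convex_hull_neqI[OF ind(1) ind(5), of a]) (simp_all add: N)
  have ne14: "convex hull {a, z, c} \<noteq> convex hull {b, z, d}"
    by (rule convex_hull_neqI[OF ind(1) ind(6), of a]) (simp_all add: N)
  have ne15: "convex hull {a, z, c} \<noteq> convex hull {z, c, d}"
    by (rule convex_hull_neqI[OF ind(1) ind(4), of a]) (simp_all add: N)
  have ne23: "convex hull {a, z, d} \<noteq> convex hull {b, z, c}"
    by (rule convex_hull_neqI[OF ind(2) ind(5), of a]) (simp_all add: N)
  have ne24: "convex hull {a, z, d} \<noteq> convex hull {b, z, d}"
    by (rule convex_hull_neqI[OF ind(2) ind(6), of a]) (simp_all add: N)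
  have ne25: "convex hull {a, z, d} \<noteq> convex hull {z, c, d}"
    by (rule convex_hull_neqI[OF ind(2) ind(4), of a]) (simp_all add: N)
  have ne34: "convex hull {b, z, c} \<noteq> convex hull {b, z, d}"
    by (rule convex_hull_neqI[OF ind(5) ind(6), of c]) (simp_all add: N)
  have ne35: "convex hull {b, z, c} \<noteq> convex hull {z, c, d}"
    by (rule convex_hull_neqI[OF ind(5) ind(4), of b]) (simp_all add: N)
  have ne45: "convex hull {b, z, d} \<noteq> convex hull {z, c, d}"
    by (rule convex_hull_neqI[OF ind(6) ind(4), of b]) (simp_all add: N)
  note ne = ne12 ne13 ne14 ne15 ne23 ne24 ne25 ne34 ne35 ne45
  show "mark S' (convex hull {a, z, c}) = convex hull {a, c}"
    "mark S' (convex hull {a, z, d}) = convex hull {a, d}"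
    "mark S' (convex hull {b, z, c}) = convex hull {b, c}"
    "mark S' (convex hull {b, z, d}) = convex hull {b, d}"
    "mark S' Z = (if eps S K = 0 then convex hull {c, d}
     else convex hull {z, THE w. w \<in> {c, d} \<and>
       mark S (convex hull {a, c, d}) = convex hull {a, w} \<and>
       mark S (convex hull {b, c, d}) = convex hull {b, w}})"
    unfolding bisect_def bisect_mark_def Let_def marked_mesh.simps fun_upd_apply
    by (simp_all only: simp_thms if_True if_False ne ne[symmetric])
qed

text \<open>The four halves differ only in the names of their vertices; those at \<open>b\<close>
  arise with \<open>x = b\<close> and \<open>w = a\<close>. Later arguments can thus treat all of
  them at once.\<close>

lemma face_of_half:
  assumes "H \<in> halves"
  obtains x w y where "H = convex hull {x, midpoint x w, y}" "\<not> affine_dependent {x, w, y}"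
    "distinct [x, w, y]" "convex hull {x, w, y} \<in> mesh_faces (tets S)"
    "mark S (convex hull {x, w, y}) = convex hull {x, w}" "mark S' H = convex hull {x, y}"
proof -
  note ind = labelled_face_independent(1,2)[OF labelled]
  have sw: "{b, a, y} = {a, b, y}" "{b, a} = {a, b}" "midpoint b a = z" for y
    by (auto simp: midpoint_sym)
  from assms show thesis
  proof (elim insertE emptyE)
    assume "H = convex hull {a, z, c}"
    then show thesis
      using that[of a b c] vertices_distinct ind faces_in ab_marked new_marks by simp
  next
    assume "H = convex hull {a, z, d}"
    then show thesis
      using that[of a b d] vertices_distinct ind faces_in ab_marked new_marks by simp
  next
    assume "H = convex hull {b, z, c}"
    then show thesis
      using that[of b a c] vertices_distinct ind faces_in ab_marked new_marks sw by simp
  next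
    assume "H = convex hull {b, z, d}"
    then show thesis
      using that[of b a d] vertices_distinct ind faces_in ab_marked new_marks sw by simp
  qed
qed

lemma Z_subset: "rel_interior Z \<subseteq> rel_interior K"
  using rel_interior_cut_subset[OF independent vertices_distinct(1)] .

lemma Z_notin: "Z \<notin> mesh_faces (tets S)"
proof
  assume "Z \<in> mesh_faces (tets S)"
  then have "Z \<inter> rel_interior K = {}"
    using face_disjoint_tet K_in by blast
  then have "rel_interior Z = {}"
    using Z_subset rel_interior_subset by blast
  then show False
    by (simp add: rel_interior_eq_empty convex_hull_eq_empty)
qed

text \<open>The only old faces that are rewritten are cut halves already present, where
  \<open>mark_half\<close> shows the written mark to be the old one; the interior face is new by
  \<open>Z_notin\<close>.\<close>

lemma mark_old:
  assumes "F \<in> mesh_faces (tets S)"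
  shows "mark S' F = mark S F"
proof (cases "F \<in> halves")
  case True
  then obtain x w y where "F = convex hull {x, midpoint x w, y}" "\<not> affine_dependent {x, w, y}"
    "distinct [x, w, y]" "convex hull {x, w, y} \<in> mesh_faces (tets S)"
    "mark S (convex hull {x, w, y}) = convex hull {x, w}" "mark S' F = convex hull {x, y}"
    by (rule face_of_half)
  then show ?thesis
    using mark_half assms by metis
next
  case False
  moreover have "F \<noteq> Z"
    using assms Z_notin by blast
  ultimately show ?thesis
    unfolding bisect_def bisect_mark_def Let_def marked_mesh.simps fun_upd_apply
      insert_iff empty_iff by simp
qed

lemma tets_new: "tets S' = (tets S - {K}) \<union> {Ka, Kb}"
  by (simp add: bisect_def Let_def)

lemma mesh_faces_new: "mesh_faces (tets S') \<subseteq> mesh_faces (tets S) \<union> halves \<union> {Z}"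
proof
  fix F assume "F \<in> mesh_faces (tets S')"
  then consider "F \<in> mesh_faces (tets S)" | "F facet_of Ka" | "F facet_of Kb"
    unfolding mesh_faces_def tets_new by blast
  then show "F \<in> mesh_faces (tets S) \<union> halves \<union> {Z}"
    by cases (use faces_in in \<open>auto simp: facet_of_labelled_iff[OF labelled_Ka]
      facet_of_labelled_iff[OF labelled_Kb]\<close>)
qed

text \<open>Freshness matters because states are indexed by point sets: the updates at
  \<open>Ka\<close> and \<open>Kb\<close> must neither touch a remaining tetrahedron nor
  collide.\<close>

lemma new_tets_fresh: "Ka \<notin> tets S - {K}" "Kb \<notin> tets S - {K}" "Ka \<noteq> Kb"
  and new_subset: "Ka \<subseteq> K" "Kb \<subseteq> K"
  and rel_interior_new: "rel_interior Ka \<subseteq> rel_interior K" "rel_interior Kb \<subseteq> rel_interior K"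
  and new_disjoint: "rel_interior Ka \<inter> Kb = {}" "rel_interior Kb \<inter> Ka = {}"
proof -
  have K_ba: "K = convex hull {b, a, c, d}" "\<not> affine_dependent {b, a, c, d}"
    using independent by (simp_all add: insert_commute)
  show sub: "Ka \<subseteq> K"
    by (rule convex_hull_half_subset)
  show sub': "Kb \<subseteq> K"
    using convex_hull_half_subset[of b a "{c, d}"] unfolding K_ba(1) midpoint_sym[of b a] .
  show ri: "rel_interior Ka \<subseteq> rel_interior K"
    by (rule rel_interior_half_subset)
  show ri': "rel_interior Kb \<subseteq> rel_interior K"
    using rel_interior_half_subset[of b a "{c, d}"] unfolding K_ba(1) midpoint_sym[of b a] .
  show disj: "rel_interior Ka \<inter> Kb = {}"
    by (rule rel_interior_half_disjoint[OF independent]) (simp_all add: vertices_distinct)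
  show "rel_interior Kb \<inter> Ka = {}"
    using rel_interior_half_disjoint[OF K_ba(2)] vertices_distinct unfolding midpoint_sym[of b a] by auto
  have ne: "rel_interior Ka \<noteq> {}" "rel_interior Kb \<noteq> {}"
    by (simp_all add: rel_interior_eq_empty convex_hull_eq_empty)
  show "Ka \<noteq> Kb"
    using disj ne(1) rel_interior_subset[of Ka] by blast
  \<comment> \<open>Any other mesh tetrahedron misses the interior of \<open>K\<close>, while a
    child has interior points there.\<close>
  have "L \<notin> tets S - {K}" if "L \<subseteq> K" "rel_interior L \<subseteq> rel_interior K" "rel_interior L \<noteq> {}" for L
    using tets_disjoint[OF K_in, of L] that rel_interior_subset[of L] by blast
  then show "Ka \<notin> tets S - {K}" "Kb \<notin> tets S - {K}"
    using sub sub' ri ri' ne by blast+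
qed

section \<open>Configuration and state of the children\<close>

text \<open>In state 1 the global refinement edge is unique and \<open>K\<close> is black with
  respect to it. So the selected edge is that edge, and the definite description in the mark of the
  interior face has the value \<open>w\<close>.\<close>

lemma eps_cases_K:
  obtains "eps S K = 0" | w w' where "eps S K = 1" "config (mark S) a b c d = Black"
    "{w, w'} = {c, d}" "w \<noteq> w'"
    "mark S (convex hull {a, c, d}) = convex hull {a, w}"
    "mark S (convex hull {b, c, d}) = convex hull {b, w}"
    "mark S' Z = convex hull {z, w}"
proof -
  consider "eps S K = 0" | e where "eps S K = 1" "global_edges (mark S) K = {e}"
    "has_config (mark S) K e Black"
    using eps_cases[OF K_in] by metis
  then show thesis
  proof cases
    case 1
    then show thesis
      by (rule that(1))
  next
    case 2
    then have "has_config (mark S) K (convex hull {a, b}) Black"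
      using ab_global by simp
    then have black: "config (mark S) a b c d = Black"
      using labelled by (rule has_configD)
    note eq = labelled_hull_eq_iff[OF labelled]
    have "mark S (convex hull {a, c, d}) = convex hull {a, c} \<and>
        mark S (convex hull {b, c, d}) = convex hull {b, c} \<or>
      mark S (convex hull {a, c, d}) = convex hull {a, d} \<and>
        mark S (convex hull {b, c, d}) = convex hull {b, d}"
      using black by (simp add: config_def Let_def split: if_splits)
    then obtain w w' where ww': "w = c \<and> w' = d \<or> w = d \<and> w' = c"
      and m: "mark S (convex hull {a, c, d}) = convex hull {a, w}"
        "mark S (convex hull {b, c, d}) = convex hull {b, w}"
      by metis
    then have w: "{w, w'} = {c, d}" "w \<noteq> w'"
      using vertices_distinct by auto
    have "(THE w. w \<in> {c, d} \<and> mark S (convex hull {a, c, d}) = convex hull {a, w} \<and>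
        mark S (convex hull {b, c, d}) = convex hull {b, w}) = w"
    proof (rule the_equality)
      show "w \<in> {c, d} \<and> mark S (convex hull {a, c, d}) = convex hull {a, w} \<and>
        mark S (convex hull {b, c, d}) = convex hull {b, w}"
        using w m by blast
      show "v = w" if "v \<in> {c, d} \<and> mark S (convex hull {a, c, d}) = convex hull {a, v} \<and>
        mark S (convex hull {b, c, d}) = convex hull {b, v}" for v
      proof -
        have "{a, v} \<subseteq> {a, b, c, d}" "{a, w} \<subseteq> {a, b, c, d}"
          using that w by auto
        then have "{a, v} = {a, w}"
          using that m eq by metis
        then show ?thesis
          by (auto simp: doubleton_eq_iff)
      qed
    qed
    then have "mark S' Z = convex hull {z, w}"
      using 2(1) by (simp add: new_marks(5))
    then show thesis
      using that(2) 2(1) black w m by blast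
  qed
qed

lemma mark_Z_edge: "mark S' Z edge_of Z"
proof -
  note edge = edge_of_triangle_iff[OF labelled_face_independent(4)[OF labelled_Ka]]
  have dist: "distinct [z, c, d]"
    using vertices_distinct midpoint_distinct by auto
  show ?thesis
  proof (cases rule: eps_cases_K)
    case 1
    then show ?thesis
      unfolding edge[OF dist] by (simp add: new_marks)
  next
    case (2 w w')
    then have "w = c \<or> w = d"
      by blast
    then show ?thesis
      unfolding edge[OF dist] using 2(7) by auto
  qed
qed

lemma old_face_marks:
  "mark S' (convex hull {a, c, d}) = mark S (convex hull {a, c, d})"
  "mark S' (convex hull {b, c, d}) = mark S (convex hull {b, c, d})"
  using mark_old faces_in by blast+

text \<open>The state decides the outcome. In state 0 the interior face is marked by
  \<open>{c, d}\<close>, as in \<open>child_black\<close>, whatever the configuration of the parent;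
  in state 1 it is marked by \<open>{z, w}\<close>, as in \<open>child_red\<close>.\<close>

lemma children:
  obtains ea eb where
    "global_edges (mark S') Ka = {ea}" "global_edges (mark S') Kb = {eb}" "eps S K = 0"
    "has_config (mark S') Ka ea Black" "has_config (mark S') Kb eb Black"
  | ea eb where
    "global_edges (mark S') Ka = {ea}" "global_edges (mark S') Kb = {eb}" "eps S K = 1"
    "config (mark S) a b c d = Black"
    "has_config (mark S') Ka ea Red" "has_config (mark S') Kb eb Red"
proof (cases rule: eps_cases_K)
  case 1
  have "\<exists>e. global_edges (mark S') Ka = {e} \<and> has_config (mark S') Ka e Black"
    using mark_edge faces_in
    by (intro child_black[OF labelled_Ka]) (simp_all add: new_marks old_face_marks 1)
  moreover have "\<exists>e. global_edges (mark S') Kb = {e} \<and> has_config (mark S') Kb e Black"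
    using mark_edge faces_in
    by (intro child_black[OF labelled_Kb]) (simp_all add: new_marks old_face_marks 1)
  ultimately show thesis
    using that(1) 1 by blast
next
  case (2 w w')
  have red: "(\<exists>e. global_edges (mark S') Ka = {e} \<and> has_config (mark S') Ka e Red) \<and>
    (\<exists>e. global_edges (mark S') Kb = {e} \<and> has_config (mark S') Kb e Red)"
  proof (cases "w = c")
    case True
    show ?thesis
      by (intro conjI child_red[OF labelled_Ka] child_red[OF labelled_Kb])
        (simp_all only: new_marks(1-4) old_face_marks 2(5-7) True)
  next
    case False
    then have w: "w = d"
      using 2(3) by blast
    \<comment> \<open>\<open>child_red\<close> treats \<open>w = c\<close>; exchanging
      \<open>c\<close> and \<open>d\<close> in the labels of the children covers
      \<open>w = d\<close>.\<close>
    have dc: "{x, d, c} = {x, c, d}" for x :: point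
      by blast
    show ?thesis
      by (intro conjI child_red[OF labelled_perms(2)[OF labelled_Ka]]
          child_red[OF labelled_perms(2)[OF labelled_Kb]])
        (simp_all only: new_marks(1-4) old_face_marks 2(5-7) dc w)
  qed
  then show thesis
    using that(2) 2(1,2) by blast
qed

lemma eps_new:
  "eps S' Ka =
      (if (\<exists>e. has_config (mark S') Ka e Black) \<and> config (mark S) a b c d = Black then 1 else 0)"
  "eps S' Kb =
      (if (\<exists>e. has_config (mark S') Kb e Black) \<and> config (mark S) a b c d = Black then 1 else 0)"
  "L \<in> tets S - {K} \<Longrightarrow> eps S' L = eps S L"
proof -
  show "eps S' Ka =
      (if (\<exists>e. has_config (mark S') Ka e Black) \<and> config (mark S) a b c d = Black then 1 else 0)"
    "eps S' Kb =
      (if (\<exists>e. has_config (mark S') Kb e Black) \<and> config (mark S) a b c d = Black then 1 else 0)"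
    using new_tets_fresh(3) by (simp_all add: bisect_def Let_def)
  show "eps S' L = eps S L" if "L \<in> tets S - {K}"
  proof -
    have "L \<noteq> Ka" "L \<noteq> Kb"
      using that new_tets_fresh by blast+
    then show ?thesis
      by (simp add: bisect_def Let_def)
  qed
qed

text \<open>The children of a parent in state 0 are black, so they get state 1 exactly when the
  parent is black; this separates the three arrows into black. A parent in state 1 is black with red
  children, whose state \<open>transition\<close> leaves open.\<close>

lemma transition_children:
  "\<exists>ea eb C. global_edges (mark S') Ka = {ea} \<and> global_edges (mark S') Kb = {eb} \<and>
     has_config (mark S') Ka ea C \<and> has_config (mark S') Kb eb C \<and>
     transition (config (mark S) a b c d) (eps S K) C (eps S' Ka) \<and>
     transition (config (mark S) a b c d) (eps S K) C (eps S' Kb)"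
proof (cases rule: children)
  case (1 ea eb)
  have "transition (config (mark S) a b c d) (eps S K) Black (eps S' Ka)"
    "transition (config (mark S) a b c d) (eps S K) Black (eps S' Kb)"
    using 1 by (cases "config (mark S) a b c d"; auto simp: transition_def eps_new(1,2))+
  then show ?thesis
    using 1 by blast
next
  case (2 ea eb)
  then have "transition (config (mark S) a b c d) (eps S K) Red i" for i
    by (simp add: transition_def)
  then show ?thesis
    using 2 by blast
qed

lemma new_tet_invariants:
  assumes "L = Ka \<or> L = Kb"
  shows "\<exists>e. global_edges (mark S') L = {e}"
    and "eps S' L = 0 \<or> eps S' L = 1 \<and>
      (\<exists>e. global_edges (mark S') L = {e} \<and> has_config (mark S') L e Black)"
proof -
  show ex: "\<exists>e. global_edges (mark S') L = {e}"
    using transition_children assms by blast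
  have "eps S' L =
      (if (\<exists>e. has_config (mark S') L e Black) \<and> config (mark S) a b c d = Black
      then 1 else 0)"
    using assms eps_new by blast
  \<comment> \<open>A child counts as black through some global refinement edge of its own; by
    uniqueness this is the edge of the invariant.\<close>
  moreover have "e \<in> global_edges (mark S') L" if "has_config (mark S') L e C" for e C
    using that by (simp add: has_config_def)
  ultimately show "eps S' L = 0 \<or> eps S' L = 1 \<and>
      (\<exists>e. global_edges (mark S') L = {e} \<and> has_config (mark S') L e Black)"
    using ex by (metis singletonD)
qed

section \<open>Preservation of the invariants\<close>

text \<open>Halves of one cut face are separated by the cut; halves of different cut faces lie in
  the disjoint relative interiors of two faces of \<open>K\<close>.\<close>

lemma halves_disjoint:
  assumes "G \<in> halves" "H \<in> halves" "rel_interior G \<inter> rel_interior H \<noteq> {}"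
  shows "G = H"
proof -
  have ind: "\<not> affine_dependent {a, b, c}" "\<not> affine_dependent {a, b, d}"
    using labelled_face_independent[OF labelled] by blast+
  have facet: "convex hull {a, b, c} face_of K" "convex hull {a, b, d} face_of K"
    unfolding face_of_convex_hull_affine_independent[OF independent]
    by (intro exI conjI refl; simp)+
  have "convex hull {a, b, c} \<noteq> convex hull {a, b, d}"
    by (rule convex_hull_neqI[OF ind, of c]) (simp_all add: vertices_distinct vertices_distinct[symmetric])
  then have disj: "rel_interior (convex hull {a, b, c}) \<inter> rel_interior (convex hull {a, b, d}) = {}"
    using face_of_eq[OF facet] by blast
  have sub: "rel_interior (convex hull {a, z, y}) \<subseteq> rel_interior (convex hull {a, b, y})"
    "rel_interior (convex hull {b, z, y}) \<subseteq> rel_interior (convex hull {a, b, y})" for y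
    using rel_interior_half_subset[of a b "{y}"] rel_interior_half_subset[of b a "{y}"]
    by (simp_all add: midpoint_sym insert_commute)
  have "rel_interior (convex hull {a, z, y}) \<inter> convex hull {b, z, y} = {}" if "y \<in> {c, d}" for y
    using that rel_interior_half_disjoint[OF ind(1)] rel_interior_half_disjoint[OF ind(2)] vertices_distinct
    by auto
  then have disj': "rel_interior (convex hull {a, z, y}) \<inter> rel_interior (convex hull {b, z, y}) = {}"
    if "y \<in> {c, d}" for y
    using that rel_interior_subset[of "convex hull {b, z, y}"] by blast
  have *: "rel_interior (convex hull {x, z, y}) \<inter> rel_interior (convex hull {x', z, y'}) = {}"
    if "x \<in> {a, b}" "x' \<in> {a, b}" "y \<in> {c, d}" "y' \<in> {c, d}" "x \<noteq> x' \<or> y \<noteq> y'" for x x' y y'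
  proof (cases "y = y'")
    case True
    with that consider "x = a" "x' = b" | "x = b" "x' = a"
      by auto
    then show ?thesis
      by cases (use disj'[OF that(3)] True in blast)+
  next
    case False
    with that consider "y = c" "y' = d" | "y = d" "y' = c"
      by auto
    moreover have "rel_interior (convex hull {x, z, y}) \<subseteq> rel_interior (convex hull {a, b, y})"
      "rel_interior (convex hull {x', z, y'}) \<subseteq> rel_interior (convex hull {a, b, y'})"
      using that(1,2) sub by blast+
    ultimately show ?thesis
      by cases (use disj in blast)+
  qed
  have "\<exists>x\<in>{a, b}. \<exists>y\<in>{c, d}. H = convex hull {x, z, y}" if "H \<in> halves" for H
    using that by blast
  then obtain x y x' y' where "x \<in> {a, b}" "x' \<in> {a, b}" "y \<in> {c, d}" "y' \<in> {c, d}"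
    "G = convex hull {x, z, y}" "H = convex hull {x', z, y'}"
    using assms(1,2) by meson
  then show ?thesis
    using * assms(3) by metis
qed

text \<open>Old faces keep their marks, a half is comparable with every old face whose relative
  interior it meets by \<open>half_comparable\<close>, and two overlapping halves coincide. The
  relative interior of the new face lies inside \<open>K\<close>, away from old faces and hence from
  halves, whose relative interiors lie in those of old faces.\<close>

lemma faces_comparable_new:
  assumes F: "F \<in> mesh_faces (tets S')" and G: "G \<in> mesh_faces (tets S')"
    and meet: "rel_interior F \<inter> rel_interior G \<noteq> {}"
  shows "comparable_faces F (mark S' F) G (mark S' G)"
proof -
  have old: "comparable_faces F (mark S' F) G (mark S' G)"
    if "F \<in> mesh_faces (tets S)" "G \<in> mesh_faces (tets S)" "rel_interior F \<inter> rel_interior G \<noteq> {}"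
    for F G
    using faces_comparable[OF that] that by (simp add: mark_old)
  have half: "comparable_faces F (mark S' F) H (mark S' H)"
    if "F \<in> mesh_faces (tets S)" "H \<in> halves" "rel_interior H \<inter> rel_interior F \<noteq> {}" for F H
  proof -
    obtain x w y where H: "H = convex hull {x, midpoint x w, y}" "\<not> affine_dependent {x, w, y}"
      "distinct [x, w, y]" "convex hull {x, w, y} \<in> mesh_faces (tets S)"
      "mark S (convex hull {x, w, y}) = convex hull {x, w}" "mark S' H = convex hull {x, y}"
      using \<open>H \<in> halves\<close> by (rule face_of_half)
    show ?thesis
      using half_comparable[OF H(2-5) that(1)] that(3) H(1,6) mark_old[OF that(1)] by simp
  qed
  have Z_old: "rel_interior Z \<inter> rel_interior F = {}" if "F \<in> mesh_faces (tets S)" for F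
    using face_disjoint_tet[OF that K_in] Z_subset rel_interior_subset[of F] by blast
  have Z_half: "rel_interior Z \<inter> rel_interior H = {}" if "H \<in> halves" for H
  proof -
    obtain x w y where H: "H = convex hull {x, midpoint x w, y}"
      "convex hull {x, w, y} \<in> mesh_faces (tets S)"
      using \<open>H \<in> halves\<close> by (rule face_of_half)
    have "rel_interior H \<subseteq> rel_interior (convex hull {x, w, y})"
      unfolding H(1) by (rule rel_interior_half_subset)
    then show ?thesis
      using Z_old[OF H(2)] by blast
  qed
  have FG: "F \<in> mesh_faces (tets S) \<or> F \<in> halves \<or> F = Z"
    "G \<in> mesh_faces (tets S) \<or> G \<in> halves \<or> G = Z"
    using F G mesh_faces_new by blast+
  show ?thesis
  proof (cases "F = G")
    case True
    then show ?thesis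
      by (simp add: comparable_faces_refl)
  next
    case False
    have meet': "rel_interior G \<inter> rel_interior F \<noteq> {}"
      using meet by blast
    have "F \<noteq> Z" "G \<noteq> Z"
      using FG Z_old Z_half meet meet' False by metis+
    then consider "F \<in> mesh_faces (tets S)" "G \<in> mesh_faces (tets S)"
      | "F \<in> mesh_faces (tets S)" "G \<in> halves" | "F \<in> halves" "G \<in> mesh_faces (tets S)"
      using FG halves_disjoint[OF _ _ meet] False by metis
    then show ?thesis
      using old half meet meet' by cases (metis comparable_faces_sym)+
  qed
qed

text \<open>Tetrahedra other than \<open>K\<close> keep the marks of their facets by
  \<open>mark_old\<close>, so their global edges and configurations carry over; the children are
  covered by \<open>new_tet_invariants\<close>.\<close>

lemma bansch_mesh_bisect: "bansch_mesh T0 S'"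
proof
  have cases: "L \<in> tets S - {K} \<or> L = Ka \<or> L = Kb" if "L \<in> tets S'" for L
    using that tets_new by blast
  have marks: "mark S' F = mark S F" if "L \<in> tets S - {K}" "F facet_of L" for L F
    using that by (intro mark_old) (auto simp: mesh_faces_def)
  have old: "global_edges (mark S') L = global_edges (mark S) L"
    "has_config (mark S') L e C \<longleftrightarrow> has_config (mark S) L e C" if "L \<in> tets S - {K}" for L e C
    using global_edges_cong has_config_cong marks[OF that] by metis+
  show "3 simplex L" if "L \<in> tets S'" for L
    using cases[OF that] tets_simplex labelled_imp_simplex[OF labelled_Ka]
      labelled_imp_simplex[OF labelled_Kb] by blast
  show "rel_interior L \<inter> M = {}" if "L \<in> tets S'" "M \<in> tets S'" "L \<noteq> M" for L M
  proof -
    \<comment> \<open>The children and their relative interiors lie in those of \<open>K\<close>, so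
      they inherit its separation from the other tetrahedra.\<close>
    have "rel_interior K \<inter> N = {}" "rel_interior N \<inter> K = {}" if "N \<in> tets S - {K}" for N
      using tets_disjoint[of K N] tets_disjoint[of N K] K_in that by blast+
    then have "rel_interior Ka \<inter> N = {}" "rel_interior N \<inter> Ka = {}"
      "rel_interior Kb \<inter> N = {}" "rel_interior N \<inter> Kb = {}" if "N \<in> tets S - {K}" for N
      using that new_subset rel_interior_new by blast+
    then show ?thesis
      using cases[OF that(1)] cases[OF that(2)] that(3) new_disjoint tets_disjoint[of L M]
      by (metis DiffD1)
  qed
  show "mark S' F edge_of F" if "F \<in> mesh_faces (tets S')" for F
  proof -
    consider "F \<in> mesh_faces (tets S)" | "F \<in> halves" | "F = Z"
      using \<open>F \<in> mesh_faces (tets S')\<close> mesh_faces_new by blast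
    then show ?thesis
    proof cases
      case 1
      then show ?thesis
        using mark_edge[of F] mark_old[of F] by metis
    next
      case 2
      then obtain x w y where H: "F = convex hull {x, midpoint x w, y}"
        "\<not> affine_dependent {x, w, y}" "distinct [x, w, y]" "mark S' F = convex hull {x, y}"
        by (rule face_of_half)
      have D': "x \<noteq> w" "x \<notin> {y}" "w \<notin> {y}" "x \<noteq> y"
        using H(3) by auto
      have "\<not> affine_dependent {x, midpoint x w, y}"
        by (rule independent_half(1)[OF H(2) D'(1-3)])
      then show ?thesis
        unfolding H(4) unfolding H(1) using D'(4)
        by (auto simp: edge_of_independent_iff)
    next
      case 3
      then show ?thesis
        using mark_Z_edge by simp
    qed
  qed
  show "global_edges (mark S') L \<noteq> {}" if "L \<in> tets S'" for L
    using cases[OF that] global_nonempty[of L] old(1)[of L] new_tet_invariants(1)[of L]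
    by (metis DiffD1 insert_not_empty)
  show "comparable_faces F (mark S' F) G (mark S' G)"
    if "F \<in> mesh_faces (tets S')" "G \<in> mesh_faces (tets S')"
      "rel_interior F \<inter> rel_interior G \<noteq> {}" for F G
    using that by (rule faces_comparable_new)
  show "eps S' L = 0 \<or> eps S' L = 1 \<and>
      (\<exists>e. global_edges (mark S') L = {e} \<and> has_config (mark S') L e Black)" if "L \<in> tets S'" for L
  proof (cases "L \<in> tets S - {K}")
    case True
    then show ?thesis
      using eps_cases[of L] old[OF True] eps_new(3)[OF True] by simp
  next
    case False
    then show ?thesis
      using cases[OF that] new_tet_invariants(2)[of L] by metis
  qed
  show "\<exists>e. global_edges (mark S') L = {e}" if "L \<in> tets S'" "L \<notin> T0" for L
  proof (cases "L \<in> tets S - {K}")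
    case True
    then show ?thesis
      using global_unique[of L] that(2) old(1)[OF True] True by (metis DiffD1)
  next
    case False
    then show ?thesis
      using cases[OF that(1)] new_tet_invariants(1)[of L] by metis
  qed
qed

end

section \<open>Induction over repeated bisection\<close>

text \<open>\<open>T0\<close> stays the initial set of tetrahedra throughout, so
  \<open>global_unique\<close> finally says that two global refinement edges force membership in the
  initial mesh.\<close>

lemma reachable_bansch_mesh:
  assumes "reachable S0 S" "admissible_initial_mesh S0"
  shows "bansch_mesh (tets S0) S"
  using assms
proof (induction rule: reachable.induct)
  case start
  then show ?case
    by (rule initial_bansch_mesh)
next
  case (step S a b c d)
  then interpret bisection "tets S0" S a b c d
    by (intro bisection.intro bisection_axioms.intro)
  show ?case
    by (rule bansch_mesh_bisect)
qed

theorem proposition6p2: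
  fixes S0 S :: marked_mesh
  assumes "admissible_initial_mesh S0"
    and "reachable S0 S"
  shows "(\<forall>a b c d. selectable S a b c d \<longrightarrow>
           (let z = midpoint a b; K = convex hull {a, b, c, d};
                Ka = convex hull {a, z, c, d}; Kb = convex hull {b, z, c, d};
                S' = bisect S a b c d
            in \<exists>ea eb C'.
                 global_edges (mark S') Ka = {ea} \<and> global_edges (mark S') Kb = {eb} \<and>
                 has_config (mark S') Ka ea C' \<and> has_config (mark S') Kb eb C' \<and>
                 transition (config (mark S) a b c d) (eps S K) C' (eps S' Ka) \<and>
                 transition (config (mark S) a b c d) (eps S K) C' (eps S' Kb)))
       \<and> (\<forall>K\<in>tets S. \<forall>e1\<in>global_edges (mark S) K. \<forall>e2\<in>global_edges (mark S) K.
            e1 \<noteq> e2 \<longrightarrow> K \<in> tets S0)"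
proof -
  interpret bansch_mesh "tets S0" S
    using assms by (intro reachable_bansch_mesh)
  show ?thesis
    unfolding Let_def
  proof (intro conjI allI impI ballI)
    fix a b c d assume "selectable S a b c d"
    then interpret bisection "tets S0" S a b c d
      by unfold_locales
    show "\<exists>ea eb C'.
       global_edges (mark S') Ka = {ea} \<and> global_edges (mark S') Kb = {eb} \<and>
       has_config (mark S') Ka ea C' \<and> has_config (mark S') Kb eb C' \<and>
       transition (config (mark S) a b c d) (eps S K) C' (eps S' Ka) \<and>
       transition (config (mark S) a b c d) (eps S K) C' (eps S' Kb)"
      by (rule transition_children)
  next
    fix K e1 e2
    assume "K \<in> tets S" "e1 \<in> global_edges (mark S) K" "e2 \<in> global_edges (mark S) K" "e1 \<noteq> e2"
    then show "K \<in> tets S0"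
      using global_unique[of K] by (metis singletonD)
  qed
qed

end
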